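(* Let $\Psi$ be a $\mathrm{GP}^2$ sentence in the normal form described in the context. Then $\Psi$ is satisfiable if and only if there is a good subgraph in $G_\Psi$.
   Context: Fix a finite vocabulary $\Sigma$ of unary and binary predicate symbols (no constants; equality allowed). For a structure $\mathcal{A}$, element $a$ and formula $\varphi(x,y)$, $|\varphi(x,y)|^{x/a}_{\mathcal{A}}$ is the number of $b$ with $\mathcal{A},x/a,y/b\models\varphi$. An LP quantifier in basic form is $\mathcal{P}(x):=\sum_{j=1}^{t}\lambda_j\cdot\#_y^{R_j(x,y)}[x\neq y]\ \circledast\ \delta$ with integers $\lambda_j,\delta$, binary predicates $R_j$, and $\circledast\in\{=,\neq,\le,\ge,<,>,\equiv_d,\not\equiv_d\}$ ($d\in\mathbb{N}$); $\mathcal{A},x/a\models\mathcal{P}(x)$ iff each $|R_j(x,y)\wedge x\neq y|^{x/a}_{\mathcal{A}}$ is finite and $\circledast$ holds after substituting these numbers for the $\#$-terms. ($\mathrm{GP}^2$ is the two-variable guarded fragment extended with such counting quantifiers; here only normal-form sentences are used.) The sentence $\Psi$ has the form $\forall x\,\gamma(x)\wedge\bigwedge_{i=1}^k\forall x\forall y\,\alpha_i(x,y)\wedge\bigwedge_{i=1}^\ell\forall x\,(q_i(x)\to\mathcal{P}_i(x))$, with $\gamma$ quantifier-free, each $\alpha_i$ of the form $(R(x,y)\wedge x\neq y)\to\beta(x,y)$ with $R$ atomic and $\beta$ quantifier-free, each $q_i$ a unary atomic predicate, and each $\mathcal{P}_i(x)=\sum_{j=1}^{t_i}\lambda_{i,j}\cdot\#_y^{R_{i,j}(x,y)}[x\neq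 y]\ \circledast_i\ \delta_i$ an LP quantifier in basic form. A unary type is a maximally consistent set of unary atoms over $x$ (including atoms $R(x,x)$ for binary $R$) or their negations; a binary type is a maximally consistent set of atoms $R(x,y)$, $R(y,x)$ (binary $R\in\Sigma$) or their negations, together with $x\neq y$. $\overline{\eta}$ denotes the binary type obtained from $\eta$ by swapping $x$ and $y$. The null type is the binary type with only negated atoms; $\Pi$ is the set of unary types and $\mathcal{K}$ the set of non-null binary types. Types are viewed as conjunctions of their elements; $\pi(y)$ is $\pi(x)$ with $x$ replaced by $y$. A graph is $G=(V,E)$ with $V\subseteq\Pi$ and $E\subseteq\Pi\times\mathcal{K}\times\Pi$ (edge $(\pi,\eta,\pi')$ goes from $\pi$ to $\pi'$ with label $\eta$); $\mathcal{N}_G(\pi)=\{(\eta,\pi'):(\pi,\eta,\pi')\in E\}$. $H=(V',E')$ is a subgraph of $G$ if $V'\subseteq V$, $E'\subseteq E$; it is non-empty if $V'\neq\emptyset$. A unary type $\pi$ is compatible with $\Psi$ if $\pi(x)\models\gamma(x)$. A triple $(\pi,\eta,\pi')\in\Pi\times\mathcal{K}\times\Pi$ is compatible with $\Psi$ if $\pi,\pi'$ are compatible and for every $1\le i\le k$: $\pi(x)\wedge\eta(x,y)\wedge\pi'(y)\models\alpha_i(x,y)$ and $\pi(y)\wedge\overline{\eta}(x,y)\wedge\pi'(x)\models\alpha_i(x,y)$. $G_\Psi$ is the graph whose vertices are the unary types compatible with $\Psi$ and whose edges are the compatible triples. For a graph $G$, a vertex $\pi$ and $1\le i\le\ell$,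 $\mathcal{Q}_i^{G,\pi}$ is the linear constraint in variables $z_{\eta',\pi'}$, $(\eta',\pi')\in\mathcal{K}\times\Pi$: \[\sum_{j=1}^{t_i}\lambda_{i,j}\cdot\Big(\sum_{(\eta',\pi')\in\mathcal{N}_G(\pi),\ R_{i,j}(x,y)\in\eta'} z_{\eta',\pi'}\Big)\ \circledast_i\ \delta_i.\] For an edge $(\pi_1,\eta,\pi_2)$ of $G$, $\mathcal{Z}^G_{\pi_1,\eta,\pi_2}$ is the system $z_{\eta,\pi_2}\ge1\wedge\bigwedge_{i:\,q_i(x)\in\pi_1}\mathcal{Q}_i^{G,\pi_1}$. An edge $(\pi_1,\eta,\pi_2)$ is bad in $G$ if $\mathcal{Z}^G_{\pi_1,\eta,\pi_2}$ has no solution in $\mathbb{N}$. A vertex $\pi$ is bad in $G$ if it has no outgoing edge in $G$ and there is $1\le i\le\ell$ with $q_i(x)\in\pi$ such that $\mathcal{Q}_i^{G,\pi}$ is not satisfied by the all-zero assignment. A non-empty subgraph $H$ of $G$ is a good subgraph of $G$ if $H$ has no bad vertex and no bad edge (badness evaluated in the graph $H$) and $H$ is symmetric: $(\pi,\eta,\pi')$ is an edge of $H$ iff $(\pi',\overline{\eta},\pi)$ is an edge of $H$. *)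

theory Defs
  imports Main "HOL-Number_Theory.Cong"
begin

record ('p, 'r) vocabulary =
  unary_syms :: "'p set"
  binary_syms :: "'r set"

definition finite_vocabulary :: "('p, 'r) vocabulary \<Rightarrow> bool" where
  "finite_vocabulary \<Sigma> \<longleftrightarrow> finite (unary_syms \<Sigma>) \<and> finite (binary_syms \<Sigma>)"

datatype var = X | Y

datatype ('p, 'r) qf =
    Pred 'p var
  | Rel 'r var var
  | Eq var var
  | Neg "('p, 'r) qf"
  | And "('p, 'r) qf" "('p, 'r) qf"
  | Or "('p, 'r) qf" "('p, 'r) qf"
  | Imp "('p, 'r) qf" "('p, 'r) qf"

abbreviation Neq :: "var \<Rightarrow> var \<Rightarrow> ('p, 'r) qf" where
  "Neq u w \<equiv> Neg (Eq u w)"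

fun qf_over :: "('p, 'r) vocabulary \<Rightarrow> var set \<Rightarrow> ('p, 'r) qf \<Rightarrow> bool" where
  "qf_over \<Sigma> W (Pred p u) \<longleftrightarrow> p \<in> unary_syms \<Sigma> \<and> u \<in> W"
| "qf_over \<Sigma> W (Rel r u w) \<longleftrightarrow> r \<in> binary_syms \<Sigma> \<and> u \<in> W \<and> w \<in> W"
| "qf_over \<Sigma> W (Eq u w) \<longleftrightarrow> u \<in> W \<and> w \<in> W"
| "qf_over \<Sigma> W (Neg \<phi>) \<longleftrightarrow> qf_over \<Sigma> W \<phi>"
| "qf_over \<Sigma> W (And \<phi> \<psi>) \<longleftrightarrow> qf_over \<Sigma> W \<phi> \<and> qf_over \<Sigma> W \<psi>"
| "qf_over \<Sigma> W (Or \<phi> \<psi>) \<longleftrightarrow> qf_over \<Sigma> W \<phi> \<and> qf_over \<Sigma> W \<psi>"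
| "qf_over \<Sigma> W (Imp \<phi> \<psi>) \<longleftrightarrow> qf_over \<Sigma> W \<phi> \<and> qf_over \<Sigma> W \<psi>"

text \<open>The interpretations are only ever consulted on elements of the carrier, so they need
  not be confined to it.\<close>

record ('u, 'p, 'r) interp =
  carr :: "'u set"
  un_rel :: "'p \<Rightarrow> 'u \<Rightarrow> bool"
  bin_rel :: "'r \<Rightarrow> 'u \<Rightarrow> 'u \<Rightarrow> bool"

fun sat :: "('u, 'p, 'r) interp \<Rightarrow> (var \<Rightarrow> 'u) \<Rightarrow> ('p, 'r) qf \<Rightarrow> bool" where
  "sat A v (Pred p u) \<longleftrightarrow> un_rel A p (v u)"
| "sat A v (Rel r u w) \<longleftrightarrow> bin_rel A r (v u) (v w)"
| "sat A v (Eq u w) \<longleftrightarrow> v u = v w"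
| "sat A v (Neg \<phi>) \<longleftrightarrow> \<not> sat A v \<phi>"
| "sat A v (And \<phi> \<psi>) \<longleftrightarrow> sat A v \<phi> \<and> sat A v \<psi>"
| "sat A v (Or \<phi> \<psi>) \<longleftrightarrow> sat A v \<phi> \<or> sat A v \<psi>"
| "sat A v (Imp \<phi> \<psi>) \<longleftrightarrow> (sat A v \<phi> \<longrightarrow> sat A v \<psi>)"

fun asg :: "'u \<Rightarrow> 'u \<Rightarrow> var \<Rightarrow> 'u" where
  "asg a b X = a"
| "asg a b Y = b"

text \<open>Structures are taken over a universe type \<open>'u\<close>: the carrier is any non-empty subset of it.\<close>

definition entails ::
  "'u itself \<Rightarrow> ('p, 'r) qf set \<Rightarrow> ('p, 'r) qf \<Rightarrow> bool" where
  "entails U \<Gamma> \<phi> \<longleftrightarrow>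
     (\<forall>A :: ('u, 'p, 'r) interp. \<forall>a \<in> carr A. \<forall>b \<in> carr A.
        (\<forall>\<psi> \<in> \<Gamma>. sat A (asg a b) \<psi>) \<longrightarrow> sat A (asg a b) \<phi>)"

datatype cmp = CEq | CNeq | CLe | CGe | CLess | CGreater | CCong nat | CNcong nat

fun holds_cmp :: "cmp \<Rightarrow> int \<Rightarrow> int \<Rightarrow> bool" where
  "holds_cmp CEq s t \<longleftrightarrow> s = t"
| "holds_cmp CNeq s t \<longleftrightarrow> s \<noteq> t"
| "holds_cmp CLe s t \<longleftrightarrow> s \<le> t"
| "holds_cmp CGe s t \<longleftrightarrow> s \<ge> t"
| "holds_cmp CLess s t \<longleftrightarrow> s < t"
| "holds_cmp CGreater s t \<longleftrightarrow> s > t"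
| "holds_cmp (CCong d) s t \<longleftrightarrow> [s = t] (mod int d)"
| "holds_cmp (CNcong d) s t \<longleftrightarrow> \<not> [s = t] (mod int d)"

record 'r lp_quant =
  lp_terms :: "(int \<times> 'r) list"
  lp_cmp :: cmp
  lp_bound :: int

definition witnesses :: "('u, 'p, 'r) interp \<Rightarrow> ('p, 'r) qf \<Rightarrow> 'u \<Rightarrow> 'u set" where
  "witnesses A \<phi> a = {b \<in> carr A. sat A (asg a b) \<phi>}"

definition sat_lp :: "('u, 'p, 'r) interp \<Rightarrow> 'u \<Rightarrow> 'r lp_quant \<Rightarrow> bool" where
  "sat_lp A a P \<longleftrightarrow>
     (\<forall>(c, R) \<in> set (lp_terms P). finite (witnesses A (And (Rel R X Y) (Neq X Y)) a)) \<and>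
     holds_cmp (lp_cmp P)
       (\<Sum>(c, R)\<leftarrow>lp_terms P. c * int (card (witnesses A (And (Rel R X Y) (Neq X Y)) a)))
       (lp_bound P)"

text \<open>A normal form is given by \<open>\<gamma>\<close>, the pairs \<open>(R, \<beta>)\<close> of guard and body of the \<open>\<alpha>\<^sub>i\<close>, and the
  pairs \<open>(q\<^sub>i, P\<^sub>i)\<close>.\<close>

record ('p, 'r) normal_form =
  nf_gamma :: "('p, 'r) qf"
  nf_guarded :: "('r \<times> ('p, 'r) qf) list"
  nf_lp :: "('p \<times> 'r lp_quant) list"

definition nf_over :: "('p, 'r) vocabulary \<Rightarrow> ('p, 'r) normal_form \<Rightarrow> bool" where
  "nf_over \<Sigma> \<Psi> \<longleftrightarrow>
     qf_over \<Sigma> {X} (nf_gamma \<Psi>) \<and>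
     (\<forall>(R, \<beta>) \<in> set (nf_guarded \<Psi>). R \<in> binary_syms \<Sigma> \<and> qf_over \<Sigma> {X, Y} \<beta>) \<and>
     (\<forall>(q, P) \<in> set (nf_lp \<Psi>).
        q \<in> unary_syms \<Sigma> \<and> (\<forall>(c, R) \<in> set (lp_terms P). R \<in> binary_syms \<Sigma>))"

definition nf_alphas :: "('p, 'r) normal_form \<Rightarrow> ('p, 'r) qf set" where
  "nf_alphas \<Psi> = (\<lambda>(R, \<beta>). Imp (And (Rel R X Y) (Neq X Y)) \<beta>) ` set (nf_guarded \<Psi>)"

definition is_model :: "('u, 'p, 'r) interp \<Rightarrow> ('p, 'r) normal_form \<Rightarrow> bool" where
  "is_model A \<Psi> \<longleftrightarrow>
     (\<forall>a \<in> carr A. sat A (\<lambda>_. a) (nf_gamma \<Psi>)) \<and>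
     (\<forall>\<alpha> \<in> nf_alphas \<Psi>. \<forall>a \<in> carr A. \<forall>b \<in> carr A. sat A (asg a b) \<alpha>) \<and>
     (\<forall>(q, P) \<in> set (nf_lp \<Psi>). \<forall>a \<in> carr A. sat A (\<lambda>_. a) (Pred q X) \<longrightarrow> sat_lp A a P)"

definition satisfiable :: "'u itself \<Rightarrow> ('p, 'r) normal_form \<Rightarrow> bool" where
  "satisfiable U \<Psi> \<longleftrightarrow> (\<exists>A :: ('u, 'p, 'r) interp. carr A \<noteq> {} \<and> is_model A \<Psi>)"

definition consistent :: "('p, 'r) qf set \<Rightarrow> bool" where
  "consistent S \<longleftrightarrow> (\<nexists>\<phi>. \<phi> \<in> S \<and> Neg \<phi> \<in> S)"

definition max_consistent :: "('p, 'r) qf set \<Rightarrow> ('p, 'r) qf set \<Rightarrow> bool" where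
  "max_consistent atoms S \<longleftrightarrow>
     S \<subseteq> atoms \<union> Neg ` atoms \<and> consistent S \<and>
     (\<forall>T. S \<subseteq> T \<and> T \<subseteq> atoms \<union> Neg ` atoms \<and> consistent T \<longrightarrow> T = S)"

definition unary_atoms :: "('p, 'r) vocabulary \<Rightarrow> ('p, 'r) qf set" where
  "unary_atoms \<Sigma> = {Pred p X |p. p \<in> unary_syms \<Sigma>} \<union> {Rel r X X |r. r \<in> binary_syms \<Sigma>}"

definition binary_atoms :: "('p, 'r) vocabulary \<Rightarrow> ('p, 'r) qf set" where
  "binary_atoms \<Sigma> = {Rel r X Y |r. r \<in> binary_syms \<Sigma>} \<union> {Rel r Y X |r. r \<in> binary_syms \<Sigma>}"

definition unary_types :: "('p, 'r) vocabulary \<Rightarrow> ('p, 'r) qf set set" where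
  "unary_types \<Sigma> = {\<pi>. max_consistent (unary_atoms \<Sigma>) \<pi>}"

definition binary_types :: "('p, 'r) vocabulary \<Rightarrow> ('p, 'r) qf set set" where
  "binary_types \<Sigma> = {insert (Neq X Y) \<eta> |\<eta>. max_consistent (binary_atoms \<Sigma>) \<eta>}"

definition null_type :: "('p, 'r) vocabulary \<Rightarrow> ('p, 'r) qf set" where
  "null_type \<Sigma> = insert (Neq X Y) (Neg ` binary_atoms \<Sigma>)"

definition nonnull_types :: "('p, 'r) vocabulary \<Rightarrow> ('p, 'r) qf set set" where
  "nonnull_types \<Sigma> = binary_types \<Sigma> - {null_type \<Sigma>}"

fun swap_var :: "var \<Rightarrow> var" where
  "swap_var X = Y"
| "swap_var Y = X"

fun swap_qf :: "('p, 'r) qf \<Rightarrow> ('p, 'r) qf" where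
  "swap_qf (Pred p u) = Pred p (swap_var u)"
| "swap_qf (Rel r u w) = Rel r (swap_var u) (swap_var w)"
| "swap_qf (Eq u w) = Eq (swap_var u) (swap_var w)"
| "swap_qf (Neg \<phi>) = Neg (swap_qf \<phi>)"
| "swap_qf (And \<phi> \<psi>) = And (swap_qf \<phi>) (swap_qf \<psi>)"
| "swap_qf (Or \<phi> \<psi>) = Or (swap_qf \<phi>) (swap_qf \<psi>)"
| "swap_qf (Imp \<phi> \<psi>) = Imp (swap_qf \<phi>) (swap_qf \<psi>)"

text \<open>For a unary type \<open>\<pi>\<close>, the set \<open>at_y \<pi>\<close> is \<open>\<pi>(y)\<close>.\<close>

definition at_y :: "('p, 'r) qf set \<Rightarrow> ('p, 'r) qf set" where
  "at_y \<pi> = swap_qf ` \<pi>"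

text \<open>Swapping turns \<open>x \<noteq> y\<close> into \<open>y \<noteq> x\<close>, which is read as the same literal; hence it is
  exempted from the renaming.\<close>

definition rev_type :: "('p, 'r) qf set \<Rightarrow> ('p, 'r) qf set" where
  "rev_type \<eta> = insert (Neq X Y) (swap_qf ` (\<eta> - {Neq X Y}))"

type_synonym ('p, 'r) edge = "('p, 'r) qf set \<times> ('p, 'r) qf set \<times> ('p, 'r) qf set"

record ('p, 'r) type_graph =
  verts :: "('p, 'r) qf set set"
  edges :: "('p, 'r) edge set"

definition is_graph :: "('p, 'r) vocabulary \<Rightarrow> ('p, 'r) type_graph \<Rightarrow> bool" where
  "is_graph \<Sigma> G \<longleftrightarrow>
     verts G \<subseteq> unary_types \<Sigma> \<and>
     edges G \<subseteq> unary_types \<Sigma> \<times> nonnull_types \<Sigma> \<times> unary_types \<Sigma>"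

definition neighbours ::
  "('p, 'r) type_graph \<Rightarrow> ('p, 'r) qf set \<Rightarrow> (('p, 'r) qf set \<times> ('p, 'r) qf set) set" where
  "neighbours G \<pi> = {(\<eta>, \<pi>'). (\<pi>, \<eta>, \<pi>') \<in> edges G}"

definition is_subgraph ::
  "('p, 'r) vocabulary \<Rightarrow> ('p, 'r) type_graph \<Rightarrow> ('p, 'r) type_graph \<Rightarrow> bool" where
  "is_subgraph \<Sigma> H G \<longleftrightarrow> is_graph \<Sigma> H \<and> verts H \<subseteq> verts G \<and> edges H \<subseteq> edges G"

definition compatible_type ::
  "'u itself \<Rightarrow> ('p, 'r) normal_form \<Rightarrow> ('p, 'r) qf set \<Rightarrow> bool" where
  "compatible_type U \<Psi> \<pi> \<longleftrightarrow> entails U \<pi> (nf_gamma \<Psi>)"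

definition compatible_edge ::
  "'u itself \<Rightarrow> ('p, 'r) normal_form \<Rightarrow> ('p, 'r) edge \<Rightarrow> bool" where
  "compatible_edge U \<Psi> = (\<lambda>(\<pi>, \<eta>, \<pi>').
     compatible_type U \<Psi> \<pi> \<and> compatible_type U \<Psi> \<pi>' \<and>
     (\<forall>\<alpha> \<in> nf_alphas \<Psi>.
        entails U (\<pi> \<union> \<eta> \<union> at_y \<pi>') \<alpha> \<and>
        entails U (at_y \<pi> \<union> rev_type \<eta> \<union> \<pi>') \<alpha>))"

definition graph_of ::
  "'u itself \<Rightarrow> ('p, 'r) vocabulary \<Rightarrow> ('p, 'r) normal_form \<Rightarrow> ('p, 'r) type_graph" where
  "graph_of U \<Sigma> \<Psi> = \<lparr>
     verts = {\<pi> \<in> unary_types \<Sigma>. compatible_type U \<Psi> \<pi>},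
     edges = {e \<in> unary_types \<Sigma> \<times> nonnull_types \<Sigma> \<times> unary_types \<Sigma>. compatible_edge U \<Psi> e}\<rparr>"

text \<open>\<open>constraint G \<pi> P z\<close> says that \<open>z\<close> satisfies the linear constraint obtained from the
  quantifier \<open>P\<close> at \<open>\<pi>\<close>.\<close>

definition constraint ::
  "('p, 'r) type_graph \<Rightarrow> ('p, 'r) qf set \<Rightarrow> 'r lp_quant \<Rightarrow>
   (('p, 'r) qf set \<times> ('p, 'r) qf set \<Rightarrow> nat) \<Rightarrow> bool" where
  "constraint G \<pi> P z \<longleftrightarrow>
     holds_cmp (lp_cmp P)
       (\<Sum>(c, R)\<leftarrow>lp_terms P.
          c * int (\<Sum>(\<eta>', \<pi>') \<in> {(\<eta>', \<pi>') \<in> neighbours G \<pi>. Rel R X Y \<in> \<eta>'}. z (\<eta>', \<pi>')))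
       (lp_bound P)"

definition edge_system ::
  "('p, 'r) normal_form \<Rightarrow> ('p, 'r) type_graph \<Rightarrow> ('p, 'r) edge \<Rightarrow>
   (('p, 'r) qf set \<times> ('p, 'r) qf set \<Rightarrow> nat) \<Rightarrow> bool" where
  "edge_system \<Psi> G = (\<lambda>(\<pi>\<^sub>1, \<eta>, \<pi>\<^sub>2) z.
     z (\<eta>, \<pi>\<^sub>2) \<ge> 1 \<and>
     (\<forall>(q, P) \<in> set (nf_lp \<Psi>). Pred q X \<in> \<pi>\<^sub>1 \<longrightarrow> constraint G \<pi>\<^sub>1 P z))"

definition bad_edge ::
  "('p, 'r) normal_form \<Rightarrow> ('p, 'r) type_graph \<Rightarrow> ('p, 'r) edge \<Rightarrow> bool" where
  "bad_edge \<Psi> G e \<longleftrightarrow> e \<in> edges G \<and> (\<nexists>z. edge_system \<Psi> G e z)"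

definition bad_vertex ::
  "('p, 'r) normal_form \<Rightarrow> ('p, 'r) type_graph \<Rightarrow> ('p, 'r) qf set \<Rightarrow> bool" where
  "bad_vertex \<Psi> G \<pi> \<longleftrightarrow>
     \<pi> \<in> verts G \<and> neighbours G \<pi> = {} \<and>
     (\<exists>(q, P) \<in> set (nf_lp \<Psi>). Pred q X \<in> \<pi> \<and> \<not> constraint G \<pi> P (\<lambda>_. 0))"

definition symmetric_graph :: "('p, 'r) vocabulary \<Rightarrow> ('p, 'r) type_graph \<Rightarrow> bool" where
  "symmetric_graph \<Sigma> G \<longleftrightarrow>
     (\<forall>\<pi> \<in> unary_types \<Sigma>. \<forall>\<eta> \<in> nonnull_types \<Sigma>. \<forall>\<pi>' \<in> unary_types \<Sigma>.
        (\<pi>, \<eta>, \<pi>') \<in> edges G \<longleftrightarrow> (\<pi>', rev_type \<eta>, \<pi>) \<in> edges G)"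

definition good_subgraph ::
  "('p, 'r) vocabulary \<Rightarrow> ('p, 'r) normal_form \<Rightarrow> ('p, 'r) type_graph \<Rightarrow>
   ('p, 'r) type_graph \<Rightarrow> bool" where
  "good_subgraph \<Sigma> \<Psi> H G \<longleftrightarrow>
     is_subgraph \<Sigma> H G \<and> verts H \<noteq> {} \<and>
     (\<nexists>\<pi>. bad_vertex \<Psi> H \<pi>) \<and> (\<nexists>e. bad_edge \<Psi> H e) \<and>
     symmetric_graph \<Sigma> H"

end

theory Submission
  imports Defs "HOL-Library.Countable_Set"
begin

text \<open>A model yields the good subgraph of all unary types and non-null binary types it realises;
  an infinite count of a binary type never contributes to a constraint that has to hold, so it
  can be replaced by \<open>1\<close>. Conversely, a good subgraph is unravelled into a tree-shaped model: a
  node entered through an edge \<open>e\<close> takes a solution of the system of the reverse of \<open>e\<close>. Since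
  that solution gives the reverse edge a value of at least \<open>1\<close>, the parent can be counted as
  one of the required neighbours, and the remaining ones are added as children.\<close>

section \<open>Types\<close>

definition lits :: "('p, 'r) qf set \<Rightarrow> ('p, 'r) qf set" where
  "lits atoms = atoms \<union> Neg ` atoms"

text \<open>The true literals decide every atom, so an extension by a false literal would contain an
  atom together with its negation.\<close>

lemma max_consistent_sat: "max_consistent atoms {\<phi> \<in> lits atoms. sat A v \<phi>}"
  unfolding max_consistent_def
proof (intro conjI allI impI)
  show "consistent {\<phi> \<in> lits atoms. sat A v \<phi>}"
    by (auto simp: consistent_def)
  fix T assume T: "{\<phi> \<in> lits atoms. sat A v \<phi>} \<subseteq> T \<and> T \<subseteq> atoms \<union> Neg ` atoms \<and> consistent T"
  have "sat A v \<phi>" if "\<phi> \<in> T" for \<phi>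
  proof (rule ccontr)
    assume n: "\<not> sat A v \<phi>"
    from that T consider "\<phi> \<in> atoms" | \<psi> where "\<phi> = Neg \<psi>" "\<psi> \<in> atoms" by blast
    then show False
    proof cases
      case 1
      then have "Neg \<phi> \<in> T" using T n by (auto simp: lits_def)
      with that T show False by (auto simp: consistent_def)
    next
      case 2
      then have "\<psi> \<in> T" using T n by (auto simp: lits_def)
      with that 2 T show False by (auto simp: consistent_def)
    qed
  qed
  with T show "T = {\<phi> \<in> lits atoms. sat A v \<phi>}" by (auto simp: lits_def)
qed (auto simp: lits_def)

section \<open>Finiteness and literals of types\<close>

lemma finite_unary_types:
  assumes "finite_vocabulary \<Sigma>" shows "finite (unary_types \<Sigma>)"
proof -
  have "finite (unary_atoms \<Sigma>)"
    using assms by (simp add: finite_vocabulary_def unary_atoms_def)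
  moreover have "unary_types \<Sigma> \<subseteq> Pow (unary_atoms \<Sigma> \<union> Neg ` unary_atoms \<Sigma>)"
    by (auto simp: unary_types_def max_consistent_def)
  ultimately show ?thesis by (meson finite_Pow_iff finite_UnI finite_imageI finite_subset)
qed

lemma finite_binary_types:
  assumes "finite_vocabulary \<Sigma>" shows "finite (binary_types \<Sigma>)"
proof -
  have "finite (binary_atoms \<Sigma>)"
    using assms by (simp add: finite_vocabulary_def binary_atoms_def)
  moreover have "binary_types \<Sigma> \<subseteq> insert (Neq X Y) ` Pow (binary_atoms \<Sigma> \<union> Neg ` binary_atoms \<Sigma>)"
    by (auto simp: binary_types_def max_consistent_def)
  ultimately show ?thesis by (meson finite_Pow_iff finite_UnI finite_imageI finite_subset)
qed

lemma finite_neighbours: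
  assumes "finite_vocabulary \<Sigma>" "is_graph \<Sigma> G"
  shows "finite (neighbours G \<pi>)"
proof (rule finite_subset)
  show "neighbours G \<pi> \<subseteq> binary_types \<Sigma> \<times> unary_types \<Sigma>"
    using assms(2) by (auto simp: neighbours_def is_graph_def nonnull_types_def)
  show "finite (binary_types \<Sigma> \<times> unary_types \<Sigma>)"
    using assms(1) by (simp add: finite_unary_types finite_binary_types)
qed

text \<open>Each negative literal comes with the absence of its atom. This is the form needed when a
  structure is read off from the positive literals of types.\<close>

lemma unary_type_literals:
  assumes "\<pi> \<in> unary_types \<Sigma>" "\<phi> \<in> \<pi>"
  obtains p where "\<phi> = Pred p X" | r where "\<phi> = Rel r X X"
    | p where "\<phi> = Neg (Pred p X)" "Pred p X \<notin> \<pi>"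
    | r where "\<phi> = Neg (Rel r X X)" "Rel r X X \<notin> \<pi>"
proof -
  from assms have m: "max_consistent (unary_atoms \<Sigma>) \<pi>" by (simp add: unary_types_def)
  then have "\<phi> \<in> unary_atoms \<Sigma> \<union> Neg ` unary_atoms \<Sigma>" using assms(2)
    by (auto simp: max_consistent_def)
  moreover have "\<psi> \<notin> \<pi>" if "\<phi> = Neg \<psi>" for \<psi>
    using m assms(2) that by (auto simp: max_consistent_def consistent_def)
  ultimately show ?thesis using that by (auto simp: unary_atoms_def)
qed

lemma binary_type_literals:
  assumes "\<eta> \<in> binary_types \<Sigma>" "\<phi> \<in> \<eta>"
  obtains "\<phi> = Neq X Y" | r where "\<phi> = Rel r X Y" | r where "\<phi> = Rel r Y X"
    | r where "\<phi> = Neg (Rel r X Y)" "Rel r X Y \<notin> \<eta>"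
    | r where "\<phi> = Neg (Rel r Y X)" "Rel r Y X \<notin> \<eta>"
proof -
  from assms obtain \<eta>' where m: "max_consistent (binary_atoms \<Sigma>) \<eta>'" and \<eta>: "\<eta> = insert (Neq X Y) \<eta>'"
    by (auto simp: binary_types_def)
  show ?thesis
  proof (cases "\<phi> = Neq X Y")
    case False
    then have \<phi>: "\<phi> \<in> \<eta>'" using assms \<eta> by auto
    then have "\<phi> \<in> binary_atoms \<Sigma> \<union> Neg ` binary_atoms \<Sigma>" using m
      by (auto simp: max_consistent_def)
    moreover have "\<psi> \<notin> \<eta>'" if "\<phi> = Neg \<psi>" for \<psi>
      using m \<phi> that by (auto simp: max_consistent_def consistent_def)
    ultimately show ?thesis using that \<eta> by (auto simp: binary_atoms_def)
  qed (use that in auto)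
qed

section \<open>Reversal of binary types\<close>

lemma swap_var_swap_var [simp]: "swap_var (swap_var u) = u"
  by (cases u) auto

lemma swap_qf_swap_qf [simp]: "swap_qf (swap_qf \<phi>) = \<phi>"
  by (induction \<phi>) auto

lemma mem_swap_qf_image_iff: "\<phi> \<in> swap_qf ` S \<longleftrightarrow> swap_qf \<phi> \<in> S"
  by (metis image_iff swap_qf_swap_qf)

text \<open>A binary type contains \<open>Neq X Y\<close> but not \<open>Neq Y X\<close>; on
  arbitrary sets, reversing twice may add or lose one of these literals.\<close>

lemma rev_type_rev_type:
  assumes "\<eta> \<in> binary_types \<Sigma>" shows "rev_type (rev_type \<eta>) = \<eta>"
proof -
  have "Neq Y X \<notin> \<eta>" "Neq X Y \<in> \<eta>"
    using assms by (auto simp: binary_types_def max_consistent_def binary_atoms_def)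
  then show ?thesis
    by (auto simp: rev_type_def mem_swap_qf_image_iff)
qed

lemma Rel_mem_rev_type_iff [simp]: "Rel r u w \<in> rev_type \<eta> \<longleftrightarrow> Rel r (swap_var u) (swap_var w) \<in> \<eta>"
  by (auto simp: rev_type_def mem_swap_qf_image_iff)

section \<open>Types realised in a structure\<close>

lemma sat_swap_qf: "sat A (asg a b) (swap_qf \<phi>) \<longleftrightarrow> sat A (asg b a) \<phi>"
proof -
  have "asg a b (swap_var u) = asg b a u" for u by (cases u) auto
  then show ?thesis by (induction \<phi>) auto
qed

lemma asg_same: "asg a a = (\<lambda>_. a)"
proof
  show "asg a a u = a" for u by (cases u) auto
qed

definition utype :: "('p, 'r) vocabulary \<Rightarrow> ('u, 'p, 'r) interp \<Rightarrow> 'u \<Rightarrow> ('p, 'r) qf set" where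
  "utype \<Sigma> A a = {\<phi> \<in> lits (unary_atoms \<Sigma>). sat A (asg a a) \<phi>}"

text \<open>\<open>Neq X Y\<close> is added whether or not \<open>a\<close> and \<open>b\<close>
  differ, so that every value is a binary type. Distinctness is demanded separately where the type
  is interpreted.\<close>

definition btype :: "('p, 'r) vocabulary \<Rightarrow> ('u, 'p, 'r) interp \<Rightarrow> 'u \<Rightarrow> 'u \<Rightarrow> ('p, 'r) qf set" where
  "btype \<Sigma> A a b = insert (Neq X Y) {\<phi> \<in> lits (binary_atoms \<Sigma>). sat A (asg a b) \<phi>}"

lemma utype_unary_types: "utype \<Sigma> A a \<in> unary_types \<Sigma>"
  unfolding unary_types_def utype_def by (simp add: max_consistent_sat)

lemma btype_binary_types: "btype \<Sigma> A a b \<in> binary_types \<Sigma>"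
  unfolding binary_types_def btype_def
  using max_consistent_sat[of _ A "asg a b"] by blast

lemma rev_type_btype: "rev_type (btype \<Sigma> A a b) = btype \<Sigma> A b a"
proof -
  have lit: "swap_qf \<phi> \<in> lits (binary_atoms \<Sigma>) \<longleftrightarrow> \<phi> \<in> lits (binary_atoms \<Sigma>)" for \<phi>
  proof -
    have *: "swap_qf \<psi> \<in> lits (binary_atoms \<Sigma>)" if "\<psi> \<in> lits (binary_atoms \<Sigma>)" for \<psi>
      using that by (auto simp: lits_def binary_atoms_def)
    show ?thesis using *[of \<phi>] *[of "swap_qf \<phi>"] by auto
  qed
  have n: "Neq Y X \<notin> lits (binary_atoms \<Sigma>)" "Neq X Y \<notin> lits (binary_atoms \<Sigma>)"
    by (auto simp: lits_def binary_atoms_def)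
  then show ?thesis
    by (auto simp: rev_type_def btype_def mem_swap_qf_image_iff lit sat_swap_qf)
qed

text \<open>This keeps a realised non-null type non-null when its two elements are
  exchanged.\<close>

lemma rev_null_type: "rev_type (null_type \<Sigma>) = null_type \<Sigma>"
proof -
  have "swap_qf \<phi> \<in> null_type \<Sigma> \<and> \<phi> \<noteq> Neq Y X" if "\<phi> \<in> null_type \<Sigma> - {Neq X Y}" for \<phi>
    using that by (auto simp: null_type_def binary_atoms_def)
  moreover have "\<phi> \<in> swap_qf ` (null_type \<Sigma> - {Neq X Y})" if "\<phi> \<in> null_type \<Sigma> - {Neq X Y}" for \<phi>
    using that unfolding mem_swap_qf_image_iff by (auto simp: null_type_def binary_atoms_def)
  ultimately show ?thesis by (auto simp: rev_type_def null_type_def[of \<Sigma>])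
qed

lemma btype_nonnull:
  assumes "bin_rel A R a b" "R \<in> binary_syms \<Sigma>"
  shows "btype \<Sigma> A a b \<in> nonnull_types \<Sigma>"
proof -
  have "Rel R X Y \<in> btype \<Sigma> A a b"
    using assms by (auto simp: btype_def lits_def binary_atoms_def)
  moreover have "Rel R X Y \<notin> null_type \<Sigma>" by (auto simp: null_type_def)
  ultimately show ?thesis by (auto simp: nonnull_types_def btype_binary_types)
qed

section \<open>Types determine the truth of quantifier-free formulas\<close>

lemma sat_cong:
  assumes "qf_over \<Sigma> W \<phi>"
    and "\<And>p u. p \<in> unary_syms \<Sigma> \<Longrightarrow> u \<in> W \<Longrightarrow> un_rel A p (v u) \<longleftrightarrow> un_rel B p (v' u)"
    and "\<And>r u w. r \<in> binary_syms \<Sigma> \<Longrightarrow> u \<in> W \<Longrightarrow> w \<in> W \<Longrightarrow>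
           bin_rel A r (v u) (v w) \<longleftrightarrow> bin_rel B r (v' u) (v' w)"
    and "\<And>u w. u \<in> W \<Longrightarrow> w \<in> W \<Longrightarrow> v u = v w \<longleftrightarrow> v' u = v' w"
  shows "sat A v \<phi> \<longleftrightarrow> sat B v' \<phi>"
  using assms by (induction \<phi>) auto

lemma sat_utypeD:
  assumes "\<forall>\<psi> \<in> utype \<Sigma> A a. sat B (\<lambda>_. a') \<psi>"
  shows "p \<in> unary_syms \<Sigma> \<Longrightarrow> un_rel B p a' \<longleftrightarrow> un_rel A p a"
    and "r \<in> binary_syms \<Sigma> \<Longrightarrow> bin_rel B r a' a' \<longleftrightarrow> bin_rel A r a a"
proof -
  assume "p \<in> unary_syms \<Sigma>"
  then have "Pred p X \<in> utype \<Sigma> A a \<or> \<not> un_rel A p a"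
    "Neg (Pred p X) \<in> utype \<Sigma> A a \<or> un_rel A p a"
    by (auto simp: utype_def lits_def unary_atoms_def)
  then show "un_rel B p a' \<longleftrightarrow> un_rel A p a" using assms by fastforce
next
  assume "r \<in> binary_syms \<Sigma>"
  then have "Rel r X X \<in> utype \<Sigma> A a \<or> \<not> bin_rel A r a a"
    "Neg (Rel r X X) \<in> utype \<Sigma> A a \<or> bin_rel A r a a"
    by (auto simp: utype_def lits_def unary_atoms_def)
  then show "bin_rel B r a' a' \<longleftrightarrow> bin_rel A r a a" using assms by fastforce
qed

lemma sat_btypeD:
  assumes "\<forall>\<psi> \<in> btype \<Sigma> A a b. sat B (asg a' b') \<psi>" and "r \<in> binary_syms \<Sigma>"
  shows "bin_rel B r a' b' \<longleftrightarrow> bin_rel A r a b" and "bin_rel B r b' a' \<longleftrightarrow> bin_rel A r b a"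
proof -
  have "Rel r X Y \<in> btype \<Sigma> A a b \<or> \<not> bin_rel A r a b"
    "Neg (Rel r X Y) \<in> btype \<Sigma> A a b \<or> bin_rel A r a b"
    using assms(2) by (auto simp: btype_def lits_def binary_atoms_def)
  then show "bin_rel B r a' b' \<longleftrightarrow> bin_rel A r a b" using assms(1) by fastforce
  have "Rel r Y X \<in> btype \<Sigma> A a b \<or> \<not> bin_rel A r b a"
    "Neg (Rel r Y X) \<in> btype \<Sigma> A a b \<or> bin_rel A r b a"
    using assms(2) by (auto simp: btype_def lits_def binary_atoms_def)
  then show "bin_rel B r b' a' \<longleftrightarrow> bin_rel A r b a" using assms(1) by fastforce
qed

lemma sat_unary_type:
  assumes "\<pi> \<in> unary_types \<Sigma>" "\<psi> \<in> \<pi>"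
  shows "sat A (asg a b) \<psi> \<longleftrightarrow> sat A (\<lambda>_. a) \<psi>"
  using assms by (auto elim: unary_type_literals)

text \<open>A unary type fixes the truth of every atom over \<open>X\<close>. Hence truth at one
  realisation gives truth at all of them, even in structures over another universe.\<close>

lemma entails_utype:
  fixes A :: "('v, 'p, 'r) interp" and U :: "'u itself"
  assumes "qf_over \<Sigma> {X} \<phi>" "sat A (\<lambda>_. a) \<phi>"
  shows "entails U (utype \<Sigma> A a) \<phi>"
  unfolding entails_def
proof (intro allI ballI impI)
  fix B :: "('u, 'p, 'r) interp" and a' b'
  assume *: "\<forall>\<psi> \<in> utype \<Sigma> A a. sat B (asg a' b') \<psi>"
  then have "\<forall>\<psi> \<in> utype \<Sigma> A a. sat B (\<lambda>_. a') \<psi>"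
    using sat_unary_type[OF utype_unary_types, of _ \<Sigma> A a B a' b'] by blast
  note D = sat_utypeD[OF this]
  have "sat B (asg a' b') \<phi> \<longleftrightarrow> sat A (\<lambda>_. a) \<phi>"
    by (rule sat_cong[OF assms(1)]) (auto simp: D)
  with assms show "sat B (asg a' b') \<phi>" by simp
qed

text \<open>The three types together decide all atoms on the pair, and \<open>Neq X Y\<close> forces
  any two realising elements to be distinct, as \<open>a\<close> and \<open>b\<close> are. So one
  true instance settles all.\<close>

lemma entails_btype:
  fixes A :: "('v, 'p, 'r) interp" and U :: "'u itself"
  assumes "qf_over \<Sigma> {X, Y} \<phi>" "sat A (asg a b) \<phi>" "a \<noteq> b"
  shows "entails U (utype \<Sigma> A a \<union> btype \<Sigma> A a b \<union> at_y (utype \<Sigma> A b)) \<phi>"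
  unfolding entails_def
proof (intro allI ballI impI)
  fix B :: "('u, 'p, 'r) interp" and a' b'
  assume *: "\<forall>\<psi> \<in> utype \<Sigma> A a \<union> btype \<Sigma> A a b \<union> at_y (utype \<Sigma> A b). sat B (asg a' b') \<psi>"
  then have "\<forall>\<psi> \<in> utype \<Sigma> A a. sat B (\<lambda>_. a') \<psi>" "\<forall>\<psi> \<in> utype \<Sigma> A b. sat B (\<lambda>_. b') \<psi>"
    using sat_unary_type[OF utype_unary_types, of _ \<Sigma> A a B a' b']
      sat_unary_type[OF utype_unary_types, of _ \<Sigma> A b B b' a'] sat_swap_qf[of B a' b']
    unfolding at_y_def by blast+
  note D = sat_utypeD[OF this(1)] sat_utypeD[OF this(2)]
  have bt: "\<forall>\<psi> \<in> btype \<Sigma> A a b. sat B (asg a' b') \<psi>" using * by blast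
  note D' = sat_btypeD[OF bt]
  have ne: "a' \<noteq> b'" using bt by (auto simp: btype_def)
  have "sat B (asg a' b') \<phi> \<longleftrightarrow> sat A (asg a b) \<phi>"
    by (rule sat_cong[OF assms(1)]) (use ne assms(3) in \<open>auto simp: D D'\<close>)
  with assms show "sat B (asg a' b') \<phi>" by simp
qed

section \<open>From a model to a good subgraph\<close>

definition realised_graph ::
  "('p, 'r) vocabulary \<Rightarrow> ('u, 'p, 'r) interp \<Rightarrow> ('p, 'r) type_graph" where
  "realised_graph \<Sigma> A = \<lparr>
     verts = utype \<Sigma> A ` carr A,
     edges = {(utype \<Sigma> A a, btype \<Sigma> A a b, utype \<Sigma> A b) |a b.
       a \<in> carr A \<and> b \<in> carr A \<and> a \<noteq> b \<and> btype \<Sigma> A a b \<in> nonnull_types \<Sigma>}\<rparr>"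

lemma is_graph_realised_graph: "is_graph \<Sigma> (realised_graph \<Sigma> A)"
  by (auto simp: is_graph_def realised_graph_def utype_unary_types)

lemma btype_nonnull_sym:
  "btype \<Sigma> A a b \<in> nonnull_types \<Sigma> \<Longrightarrow> btype \<Sigma> A b a \<in> nonnull_types \<Sigma>"
  by (metis DiffE DiffI btype_binary_types nonnull_types_def rev_null_type rev_type_btype
      singleton_iff)

lemma symmetric_realised_graph: "symmetric_graph \<Sigma> (realised_graph \<Sigma> A)"
proof -
  \<comment> \<open>One direction suffices, because reversal is an involution on binary
    types.\<close>
  have *: "(\<pi>', rev_type \<eta>, \<pi>) \<in> edges (realised_graph \<Sigma> A)"
    if "(\<pi>, \<eta>, \<pi>') \<in> edges (realised_graph \<Sigma> A)" for \<pi> \<eta> \<pi>'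
    using that btype_nonnull_sym unfolding realised_graph_def by (fastforce simp: rev_type_btype)
  show ?thesis
    unfolding symmetric_graph_def
    using * by (metis DiffD1 nonnull_types_def rev_type_rev_type)
qed

lemma realised_subgraph:
  assumes nf: "nf_over \<Sigma> \<Psi>" and A: "is_model (A :: ('u, 'p, 'r) interp) \<Psi>"
  shows "is_subgraph \<Sigma> (realised_graph \<Sigma> A) (graph_of TYPE('u) \<Sigma> \<Psi>)"
proof -
  have ct: "compatible_type TYPE('u) \<Psi> (utype \<Sigma> A a)" if "a \<in> carr A" for a
    using that nf A unfolding compatible_type_def nf_over_def is_model_def
    by (intro entails_utype) blast+
  have al: "entails TYPE('u) (utype \<Sigma> A a \<union> btype \<Sigma> A a b \<union> at_y (utype \<Sigma> A b)) \<alpha>"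
    if "a \<in> carr A" "b \<in> carr A" "a \<noteq> b" "\<alpha> \<in> nf_alphas \<Psi>" for a b \<alpha>
  proof (rule entails_btype)
    show "qf_over \<Sigma> {X, Y} \<alpha>"
      using nf that(4) by (auto simp: nf_over_def nf_alphas_def)
    show "sat A (asg a b) \<alpha>" using A that by (auto simp: is_model_def)
  qed fact
  \<comment> \<open>The second entailment in compatibility is the first one for the exchanged pair
    \<open>b\<close>, \<open>a\<close>.\<close>
  have ce: "compatible_edge TYPE('u) \<Psi> (utype \<Sigma> A a, btype \<Sigma> A a b, utype \<Sigma> A b)"
    if "a \<in> carr A" "b \<in> carr A" "a \<noteq> b" for a b
    using that al[of a b] al[of b a] ct unfolding compatible_edge_def
    by (simp add: rev_type_btype Un_commute Un_left_commute)
  have "edges (realised_graph \<Sigma> A) \<subseteq> edges (graph_of TYPE('u) \<Sigma> \<Psi>)"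
    using ce by (auto simp: realised_graph_def graph_of_def utype_unary_types)
  moreover have "verts (realised_graph \<Sigma> A) \<subseteq> verts (graph_of TYPE('u) \<Sigma> \<Psi>)"
    using ct by (auto simp: realised_graph_def graph_of_def utype_unary_types)
  ultimately show ?thesis
    by (simp add: is_subgraph_def is_graph_realised_graph)
qed

section \<open>Counting witnesses by their types\<close>

definition realisers ::
  "('p, 'r) vocabulary \<Rightarrow> ('u, 'p, 'r) interp \<Rightarrow> 'u \<Rightarrow> ('p, 'r) qf set \<times> ('p, 'r) qf set \<Rightarrow> 'u set" where
  "realisers \<Sigma> A a = (\<lambda>(\<eta>, \<pi>). {b \<in> carr A. a \<noteq> b \<and> btype \<Sigma> A a b = \<eta> \<and> utype \<Sigma> A b = \<pi>})"

text \<open>An \<open>R\<close>-witness has a non-null type with \<open>a\<close>, so its types form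
  an edge of the realised graph. The sets \<open>realisers\<close> are disjoint for different
  indices, and their sizes are the intended values of the variables of the constraint.\<close>

lemma witnesses_eq_realisers:
  assumes "R \<in> binary_syms \<Sigma>" "a \<in> carr A"
  shows "witnesses A (And (Rel R X Y) (Neq X Y)) a =
    (\<Union>n \<in> {(\<eta>', \<pi>') \<in> neighbours (realised_graph \<Sigma> A) (utype \<Sigma> A a). Rel R X Y \<in> \<eta>'}.
      realisers \<Sigma> A a n)" (is "?W = ?U")
proof
  have iff: "Rel R X Y \<in> btype \<Sigma> A a b \<longleftrightarrow> bin_rel A R a b" for b
    using assms by (auto simp: btype_def lits_def binary_atoms_def)
  show "?W \<subseteq> ?U"
  proof
    fix b assume "b \<in> ?W"
    then have b: "b \<in> carr A" "bin_rel A R a b" "a \<noteq> b" by (auto simp: witnesses_def)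
    then have "(btype \<Sigma> A a b, utype \<Sigma> A b) \<in> neighbours (realised_graph \<Sigma> A) (utype \<Sigma> A a)"
      using assms btype_nonnull[OF b(2) assms(1)]
      by (auto simp: neighbours_def realised_graph_def)
    then show "b \<in> ?U" using b iff by (auto simp: realisers_def)
  qed
  show "?U \<subseteq> ?W"
    using iff by (auto simp: witnesses_def realisers_def)
qed

text \<open>The finiteness clause of \<open>sat_lp\<close> makes \<open>realisers\<close> finite at
  every index that the constraint sums over. The values of \<open>z\<close> at infinite sets can
  therefore be chosen freely.\<close>

lemma constraint_realised:
  fixes z
  assumes fin: "finite_vocabulary \<Sigma>" and a: "a \<in> carr A" and P: "sat_lp A a P"
    and R: "\<forall>(c, R) \<in> set (lp_terms P). R \<in> binary_syms \<Sigma>"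
    and z: "\<And>n. finite (realisers \<Sigma> A a n) \<Longrightarrow> z n = card (realisers \<Sigma> A a n)"
  shows "constraint (realised_graph \<Sigma> A) (utype \<Sigma> A a) P z"
proof -
  let ?N = "\<lambda>R. {(\<eta>', \<pi>') \<in> neighbours (realised_graph \<Sigma> A) (utype \<Sigma> A a). Rel R X Y \<in> \<eta>'}"
  have "card (witnesses A (And (Rel R X Y) (Neq X Y)) a) = (\<Sum>(\<eta>', \<pi>') \<in> ?N R. z (\<eta>', \<pi>'))"
    if "(c, R) \<in> set (lp_terms P)" for c R
  proof -
    have W: "witnesses A (And (Rel R X Y) (Neq X Y)) a = (\<Union>n \<in> ?N R. realisers \<Sigma> A a n)"
      using that R a by (intro witnesses_eq_realisers) auto
    have "finite (witnesses A (And (Rel R X Y) (Neq X Y)) a)"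
      using P that by (auto simp: sat_lp_def)
    then have f: "finite (realisers \<Sigma> A a n)" if "n \<in> ?N R" for n
      using W that by (metis (no_types, lifting) UN_upper finite_subset)
    have "finite (?N R)"
      by (rule finite_subset[OF _ finite_neighbours[OF fin is_graph_realised_graph]]) auto
    then have "card (witnesses A (And (Rel R X Y) (Neq X Y)) a) = (\<Sum>n \<in> ?N R. card (realisers \<Sigma> A a n))"
      unfolding W using f by (intro card_UN_disjoint) (auto simp: realisers_def)
    also have "\<dots> = (\<Sum>n \<in> ?N R. z n)" using f z by (intro sum.cong) auto
    finally show ?thesis by (simp add: case_prod_unfold)
  qed
  then have "(\<Sum>(c, R)\<leftarrow>lp_terms P. c * int (card (witnesses A (And (Rel R X Y) (Neq X Y)) a))) =
     (\<Sum>(c, R)\<leftarrow>lp_terms P. c * int (\<Sum>(\<eta>', \<pi>') \<in> ?N R. z (\<eta>', \<pi>')))"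
    by (intro arg_cong[where f = sum_list] map_cong) auto
  then show ?thesis using P by (simp add: constraint_def sat_lp_def)
qed

lemma good_realised_graph:
  assumes fin: "finite_vocabulary \<Sigma>" and nf: "nf_over \<Sigma> \<Psi>"
    and A: "is_model (A :: ('u, 'p, 'r) interp) \<Psi>" and ne: "carr A \<noteq> {}"
  shows "good_subgraph \<Sigma> \<Psi> (realised_graph \<Sigma> A) (graph_of TYPE('u) \<Sigma> \<Psi>)"
proof -
  have P: "sat_lp A a P" "\<forall>(c, R) \<in> set (lp_terms P). R \<in> binary_syms \<Sigma>"
    if "(q, P) \<in> set (nf_lp \<Psi>)" "Pred q X \<in> utype \<Sigma> A a" "a \<in> carr A" for q P a
    using nf A that by (auto simp: nf_over_def is_model_def utype_def)
  have "\<not> bad_vertex \<Psi> (realised_graph \<Sigma> A) \<pi>" for \<pi>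
  proof
    assume b: "bad_vertex \<Psi> (realised_graph \<Sigma> A) \<pi>"
    then obtain a where a: "a \<in> carr A" "\<pi> = utype \<Sigma> A a"
      by (auto simp: bad_vertex_def realised_graph_def)
    obtain q Q where Q: "(q, Q) \<in> set (nf_lp \<Psi>)" "Pred q X \<in> \<pi>"
      "\<not> constraint (realised_graph \<Sigma> A) \<pi> Q (\<lambda>_. 0)"
      using b by (auto simp: bad_vertex_def)
    \<comment> \<open>Without neighbours all the sums are empty, so this assignment and the zero
      assignment satisfy the same constraints.\<close>
    have "constraint (realised_graph \<Sigma> A) \<pi> Q (\<lambda>n. card (realisers \<Sigma> A a n))"
      unfolding a(2) using P[OF Q(1)] Q(2) a by (intro constraint_realised[OF fin]) auto
    moreover have "neighbours (realised_graph \<Sigma> A) \<pi> = {}"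
      using b by (simp add: bad_vertex_def)
    ultimately show False using Q(3) by (simp add: constraint_def)
  qed
  moreover have "\<not> bad_edge \<Psi> (realised_graph \<Sigma> A) e" for e
  proof
    assume b: "bad_edge \<Psi> (realised_graph \<Sigma> A) e"
    then obtain a b where ab: "a \<in> carr A" "b \<in> carr A" "a \<noteq> b"
      "e = (utype \<Sigma> A a, btype \<Sigma> A a b, utype \<Sigma> A b)"
      by (auto simp: bad_edge_def realised_graph_def)
    \<comment> \<open>The variable of the edge \<open>e\<close> must be at least \<open>1\<close>,
      but \<open>card\<close> of an infinite set is \<open>0\<close>; hence the default
      \<open>1\<close>.\<close>
    define z where "z n = (if finite (realisers \<Sigma> A a n) then card (realisers \<Sigma> A a n) else 1)" for n
    have "b \<in> realisers \<Sigma> A a (btype \<Sigma> A a b, utype \<Sigma> A b)"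
      using ab by (auto simp: realisers_def)
    then have "z (btype \<Sigma> A a b, utype \<Sigma> A b) \<ge> 1"
      by (auto simp: z_def Suc_le_eq card_gt_0_iff)
    moreover have "constraint (realised_graph \<Sigma> A) (utype \<Sigma> A a) Q z"
      if "(q, Q) \<in> set (nf_lp \<Psi>)" "Pred q X \<in> utype \<Sigma> A a" for q Q
      using P[OF that ab(1)] ab(1) by (intro constraint_realised[OF fin]) (auto simp: z_def)
    ultimately have "edge_system \<Psi> (realised_graph \<Sigma> A) e z"
      by (auto simp: edge_system_def ab(4))
    with b show False by (auto simp: bad_edge_def)
  qed
  ultimately show ?thesis
    using realised_subgraph[OF nf A] symmetric_realised_graph ne
    by (auto simp: good_subgraph_def) (auto simp: realised_graph_def)
qed

section \<open>Unravelling a graph\<close>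

text \<open>A node is the path from the root, last step first; the number in a step distinguishes
  siblings. The index \<open>0\<close> of the edge back to the parent is reserved for the parent itself.\<close>

locale unravelling =
  fixes E :: "('t \<times> 'l \<times> 't) set" and rv :: "'l \<Rightarrow> 'l"
    and r0 :: 't and zr :: "'l \<times> 't \<Rightarrow> nat" and zs :: "'t \<times> 'l \<times> 't \<Rightarrow> 'l \<times> 't \<Rightarrow> nat"
  assumes E_rv: "(s, l, t) \<in> E \<Longrightarrow> (t, rv l, s) \<in> E"
    and rv_rv: "(s, l, t) \<in> E \<Longrightarrow> rv (rv l) = l"
    and zs_pos: "(s, l, t) \<in> E \<Longrightarrow> zs (s, l, t) (l, t) \<ge> 1"
    and finite_out: "finite {(l, t). (s, l, t) \<in> E}"
begin

fun tp :: "('l \<times> 't \<times> nat) list \<Rightarrow> 't" where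
  "tp [] = r0"
| "tp ((l, t, k) # w) = t"

fun sol :: "('l \<times> 't \<times> nat) list \<Rightarrow> 'l \<times> 't \<Rightarrow> nat" where
  "sol [] = zr"
| "sol ((l, t, k) # w) = zs (t, rv l, tp w)"

text \<open>The index of \<open>sol\<close> under which a node counts its parent; the root has no
  parent to count.\<close>

fun back_edge :: "('l \<times> 't \<times> nat) list \<Rightarrow> ('l \<times> 't) option" where
  "back_edge [] = None"
| "back_edge ((l, t, k) # w) = Some (rv l, tp w)"

inductive_set nodes :: "('l \<times> 't \<times> nat) list set" where
  root: "[] \<in> nodes"
| step: "(l, t, k) # w \<in> nodes" if "w \<in> nodes" "(tp w, l, t) \<in> E" "k < sol w (l, t)"
    "\<not> (k = 0 \<and> back_edge w = Some (l, t))"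

lemma Cons_nodes_iff:
  "(l, t, k) # w \<in> nodes \<longleftrightarrow> w \<in> nodes \<and> (tp w, l, t) \<in> E \<and> k < sol w (l, t) \<and>
     \<not> (k = 0 \<and> back_edge w = Some (l, t))"
  by (auto elim: nodes.cases intro: nodes.step)

text \<open>The label of a pair of tree neighbours, reversed when read from child to parent.
  \<open>None\<close> plays the part of the null type. The tests against \<open>[]\<close> are there
  because \<open>tl [] = []\<close>, which would otherwise label the root with itself.\<close>

definition lab :: "('l \<times> 't \<times> nat) list \<Rightarrow> ('l \<times> 't \<times> nat) list \<Rightarrow> 'l option" where
  "lab a b = (if b \<noteq> [] \<and> tl b = a then Some (fst (hd b))
              else if a \<noteq> [] \<and> tl a = b then Some (rv (fst (hd a))) else None)"

lemma tl_neq_Cons: "tl w \<noteq> x # w"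
proof
  assume "tl w = x # w"
  then have "length (tl w) = length (x # w)" by simp
  then show False by simp
qed

lemma lab_Cons [simp]: "lab w ((l, t, k) # w) = Some l"
  "lab ((l, t, k) # w) w = Some (rv l)"
  by (auto simp: lab_def tl_neq_Cons)

lemma lab_cases:
  assumes "lab a b = Some l"
  obtains t k where "b = (l, t, k) # a" | l' t k where "a = (l', t, k) # b" "l = rv l'"
proof -
  from assms consider "b \<noteq> []" "tl b = a" "l = fst (hd b)" | "a \<noteq> []" "tl a = b" "l = rv (fst (hd a))"
    by (auto simp: lab_def split: if_splits)
  then show ?thesis
  proof cases
    case 1
    then show ?thesis using that(1) by (cases b) auto
  next
    case 2
    then show ?thesis using that(2) by (cases a) auto
  qed
qed

lemma lab_neq: "lab a b = Some l \<Longrightarrow> a \<noteq> b"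
  by (auto elim: lab_cases)

lemma lab_edge:
  assumes "lab a b = Some l" "a \<in> nodes" "b \<in> nodes"
  shows "(tp a, l, tp b) \<in> E"
  using assms(1) by (rule lab_cases) (use assms in \<open>auto simp: Cons_nodes_iff intro: E_rv\<close>)

lemma lab_sym:
  assumes "lab a b = Some l" "a \<in> nodes" "b \<in> nodes"
  shows "lab b a = Some (rv l)"
  using assms(1) by (rule lab_cases) (use assms in \<open>auto simp: Cons_nodes_iff rv_rv\<close>)

section \<open>Enumerating and counting the neighbours of a node\<close>

definition nb :: "('l \<times> 't \<times> nat) list \<Rightarrow> ('l \<times> 't) \<times> nat \<Rightarrow> ('l \<times> 't \<times> nat) list" where
  "nb w = (\<lambda>((l, t), k). if k = 0 \<and> back_edge w = Some (l, t) then tl w else (l, t, k) # w)"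

text \<open>A child is longer than \<open>w\<close> and the parent is not, so the two cannot
  coincide. Only one index, number \<open>0\<close> of the back edge, is sent to the parent.\<close>

lemma inj_nb: "inj (nb w)"
proof (rule injI)
  fix x y assume eq: "nb w x = nb w y"
  obtain l t k l' t' k' where xy: "x = ((l, t), k)" "y = ((l', t'), k')"
    by (metis prod.exhaust)
  show "x = y"
    using eq tl_neq_Cons[of w "(l, t, k)"] tl_neq_Cons[of w "(l', t', k')"]
    unfolding xy nb_def by (simp split: if_splits)
qed

text \<open>Each index \<open>n\<close> contributes exactly the numbers below
  \<open>sol w n\<close>. The child missing at number \<open>0\<close> of the back edge is replaced
  by the parent, so the totals agree with the chosen solution.\<close>

lemma labelled_neighbours:
  assumes w: "w \<in> nodes"
  shows "{b \<in> nodes. \<exists>l. lab w b = Some l \<and> Q l} =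
    nb w ` (SIGMA n:{(l, t). (tp w, l, t) \<in> E \<and> Q l}. {..<sol w n})" (is "?L = ?R")
proof
  show "?L \<subseteq> ?R"
  proof
    fix b assume "b \<in> ?L"
    then obtain l where b: "b \<in> nodes" "lab w b = Some l" "Q l" by auto
    from b(2) show "b \<in> ?R"
    proof (cases rule: lab_cases)
      case (1 t k)
      then have "b = nb w ((l, t), k)" using b by (auto simp: nb_def Cons_nodes_iff)
      moreover have "(tp w, l, t) \<in> E" "k < sol w (l, t)"
        using 1 b by (auto simp: Cons_nodes_iff)
      ultimately show ?thesis using b by (intro image_eqI[where x = "((l, t), k)"]) auto
    next
      case (2 l' t k)
      then have E: "(tp b, l', t) \<in> E" using w by (auto simp: Cons_nodes_iff)
      have "b = nb w ((l, tp b), 0)" using 2 by (auto simp: nb_def)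
      \<comment> \<open>Here \<open>b\<close> is the parent, and \<open>sol w\<close> solves the
        system of the edge from \<open>w\<close> back to \<open>b\<close>. By \<open>zs_pos\<close>
        its value there is at least \<open>1\<close>, so the reserved number \<open>0\<close> is in
        range.\<close>
      moreover have "(tp w, l, tp b) \<in> E" "0 < sol w (l, tp b)"
        using 2 E_rv[OF E] zs_pos[OF E_rv[OF E]] by auto
      ultimately show ?thesis using b by (intro image_eqI[where x = "((l, tp b), 0)"]) auto
    qed
  qed
  show "?R \<subseteq> ?L"
  proof
    fix b assume "b \<in> ?R"
    then obtain l t k where b: "b = nb w ((l, t), k)" "(tp w, l, t) \<in> E" "Q l" "k < sol w (l, t)"
      by auto
    show "b \<in> ?L"
    proof (cases "k = 0 \<and> back_edge w = Some (l, t)")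
      case True
      then obtain l' t' k' w' where "w = (l', t', k') # w'" "l = rv l'"
        by (cases w rule: back_edge.cases) auto
      then show ?thesis using True b w by (auto simp: nb_def Cons_nodes_iff)
    next
      case False
      then have "b = (l, t, k) # w" using b by (auto simp: nb_def)
      then show ?thesis using False b w by (auto simp: Cons_nodes_iff)
    qed
  qed
qed

lemma finite_labelled_neighbours:
  assumes "w \<in> nodes"
  shows "finite {b \<in> nodes. \<exists>l. lab w b = Some l \<and> Q l}"
proof -
  have "finite {(l, t). (tp w, l, t) \<in> E \<and> Q l}"
    by (rule finite_subset[OF _ finite_out[of "tp w"]]) auto
  then show ?thesis unfolding labelled_neighbours[OF assms] by auto
qed

lemma card_labelled_neighbours:
  assumes "w \<in> nodes"
  shows "card {b \<in> nodes. \<exists>l. lab w b = Some l \<and> Q l} =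
    (\<Sum>n \<in> {(l, t). (tp w, l, t) \<in> E \<and> Q l}. sol w n)"
proof -
  have "finite {(l, t). (tp w, l, t) \<in> E \<and> Q l}"
    by (rule finite_subset[OF _ finite_out[of "tp w"]]) auto
  then show ?thesis
    unfolding labelled_neighbours[OF assms]
    by (simp add: card_image[OF inj_on_subset[OF inj_nb]])
qed

text \<open>Nodes are finite lists over the finitely many labels and types in \<open>E\<close> and
  the natural numbers. Countability allows the tree to be copied into any infinite universe.\<close>

lemma countable_nodes:
  assumes "finite E" shows "countable nodes"
proof -
  let ?S = "(\<lambda>(s, l, t). l) ` E \<times> (\<lambda>(s, l, t). t) ` E \<times> (UNIV :: nat set)"
  have "w \<in> lists ?S" if "w \<in> nodes" for w
    using that by (induction rule: nodes.induct) force+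
  moreover have "countable (lists ?S)"
    using assms by (intro countable_lists countable_SIGMA) (auto intro: countable_finite)
  ultimately show ?thesis by (meson countable_subset subsetI)
qed

end

section \<open>Changing the universe\<close>

text \<open>The tree model consists of lists, whereas satisfiability and entailment refer to a fixed
  universe \<open>'u\<close>. The map \<open>g\<close> will be injective on the carrier, so
  \<open>inv_into\<close> undoes it there; values outside the image are arbitrary.\<close>

definition image_interp :: "('v \<Rightarrow> 'u) \<Rightarrow> ('v, 'p, 'r) interp \<Rightarrow> ('u, 'p, 'r) interp" where
  "image_interp g B = \<lparr>
     carr = g ` carr B,
     un_rel = \<lambda>p a. un_rel B p (inv_into (carr B) g a),
     bin_rel = \<lambda>r a b. bin_rel B r (inv_into (carr B) g a) (inv_into (carr B) g b)\<rparr>"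

lemma sat_image_interp:
  assumes "inj_on g (carr B)" "\<And>u. v u \<in> carr B"
  shows "sat (image_interp g B) (\<lambda>u. g (v u)) \<phi> \<longleftrightarrow> sat B v \<phi>"
proof (induction \<phi>)
  case (Eq u w)
  show ?case using inj_onD[OF assms(1) _ assms(2,2)] by auto
qed (auto simp: image_interp_def assms)

lemma sat_image_interp_asg:
  assumes "inj_on g (carr B)" "a \<in> carr B" "b \<in> carr B"
  shows "sat (image_interp g B) (asg (g a) (g b)) \<phi> \<longleftrightarrow> sat B (asg a b) \<phi>"
proof -
  have "asg (g a) (g b) = (\<lambda>u. g (asg a b u))"
  proof
    show "asg (g a) (g b) u = g (asg a b u)" for u by (cases u) auto
  qed
  moreover have "asg a b u \<in> carr B" for u using assms by (cases u) auto
  ultimately show ?thesis using sat_image_interp[OF assms(1), of "asg a b"] by simp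
qed

lemma witnesses_image_interp:
  assumes "inj_on g (carr B)" "a \<in> carr B"
  shows "witnesses (image_interp g B) \<phi> (g a) = g ` witnesses B \<phi> a"
proof -
  have "carr (image_interp g B) = g ` carr B" by (simp add: image_interp_def)
  then show ?thesis using sat_image_interp_asg[OF assms] by (auto simp: witnesses_def)
qed

lemma sat_lp_image_interp:
  assumes "inj_on g (carr B)" "a \<in> carr B"
  shows "sat_lp (image_interp g B) (g a) P \<longleftrightarrow> sat_lp B a P"
proof -
  have "inj_on g (witnesses B \<phi> a)" for \<phi>
    by (rule inj_on_subset[OF assms(1)]) (auto simp: witnesses_def)
  then show ?thesis
    by (simp add: sat_lp_def witnesses_image_interp[OF assms] card_image finite_image_iff)
qed

section \<open>Moving countable structures into an infinite universe\<close>

lemma ex_inj_on_countable: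
  assumes "countable (S :: 'v set)" "infinite (UNIV :: 'u set)"
  obtains g :: "'v \<Rightarrow> 'u" where "inj_on g S"
proof -
  obtain h :: "nat \<Rightarrow> 'u" where "inj h"
    using infinite_countable_subset[OF assms(2)] by auto
  then have "inj_on (h \<circ> to_nat_on S) S"
    using assms(1) by (intro comp_inj_on) (auto intro: inj_on_subset)
  then show ?thesis using that by blast
qed

lemma satisfiable_transfer:
  fixes B :: "('v, 'p, 'r) interp"
  assumes inf: "infinite (UNIV :: 'u set)" and "countable (carr B)" "carr B \<noteq> {}"
    and B: "is_model B \<Psi>"
  shows "satisfiable TYPE('u) \<Psi>"
proof -
  obtain g :: "'v \<Rightarrow> 'u" where g: "inj_on g (carr B)"
    using ex_inj_on_countable assms by blast
  have c: "carr (image_interp g B) = g ` carr B" by (simp add: image_interp_def)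
  have "sat (image_interp g B) (\<lambda>_. g a) \<phi> \<longleftrightarrow> sat B (\<lambda>_. a) \<phi>" if "a \<in> carr B" for a \<phi>
    using sat_image_interp[OF g, of "\<lambda>_. a"] that by simp
  then have "is_model (image_interp g B) \<Psi>"
    using B unfolding is_model_def c
    by (auto simp del: sat.simps simp: sat_image_interp_asg[OF g] sat_lp_image_interp[OF g])
  then show ?thesis using assms(3) c by (auto simp: satisfiable_def)
qed

text \<open>Compatibility only speaks of structures over \<open>'u\<close>. It is applied to an
  isomorphic copy of \<open>B\<close> there, and the conclusion is pulled back.\<close>

lemma entails_transfer:
  fixes B :: "('v, 'p, 'r) interp"
  assumes inf: "infinite (UNIV :: 'u set)" and "countable (carr B)"
    and ent: "entails TYPE('u) \<Gamma> \<phi>" and ab: "a \<in> carr B" "b \<in> carr B"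
    and sat: "\<And>\<psi>. \<psi> \<in> \<Gamma> \<Longrightarrow> sat B (asg a b) \<psi>"
  shows "sat B (asg a b) \<phi>"
proof -
  obtain g :: "'v \<Rightarrow> 'u" where g: "inj_on g (carr B)"
    using ex_inj_on_countable assms by blast
  have "g a \<in> carr (image_interp g B)" "g b \<in> carr (image_interp g B)"
    using ab by (auto simp: image_interp_def)
  then have "sat (image_interp g B) (asg (g a) (g b)) \<phi>"
    using ent sat sat_image_interp_asg[OF g ab] unfolding entails_def by blast
  then show ?thesis using sat_image_interp_asg[OF g ab] by blast
qed

section \<open>From a good subgraph to a model\<close>

text \<open>The root has no parent, so its solution \<open>zr\<close> only has to satisfy the
  constraints at \<open>r0\<close>. The system of any outgoing edge supplies one; if there is none,
  zero works because \<open>r0\<close> is not a bad vertex.\<close>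

lemma good_subgraph_solutions:
  assumes "good_subgraph \<Sigma> \<Psi> H G"
  obtains r0 zr zs where "r0 \<in> verts H"
    and "\<And>q P. (q, P) \<in> set (nf_lp \<Psi>) \<Longrightarrow> Pred q X \<in> r0 \<Longrightarrow> constraint H r0 P zr"
    and "\<And>e. e \<in> edges H \<Longrightarrow> edge_system \<Psi> H e (zs e)"
proof -
  obtain r0 where r0: "r0 \<in> verts H" using assms by (auto simp: good_subgraph_def)
  have "\<forall>e. \<exists>z. e \<in> edges H \<longrightarrow> edge_system \<Psi> H e z"
    using assms by (auto simp: good_subgraph_def bad_edge_def)
  then obtain zs where zs: "\<And>e. e \<in> edges H \<Longrightarrow> edge_system \<Psi> H e (zs e)" by metis
  have "\<exists>zr. \<forall>(q, P) \<in> set (nf_lp \<Psi>). Pred q X \<in> r0 \<longrightarrow> constraint H r0 P zr"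
  proof (cases "neighbours H r0 = {}")
    case True
    have "\<not> bad_vertex \<Psi> H r0" using assms by (auto simp: good_subgraph_def)
    then show ?thesis using True r0 by (auto simp: bad_vertex_def)
  next
    case False
    then obtain \<eta> \<pi> where "(r0, \<eta>, \<pi>) \<in> edges H" by (auto simp: neighbours_def)
    then show ?thesis using zs by (fastforce simp: edge_system_def)
  qed
  then show ?thesis using that r0 zs by blast
qed

lemma satisfiable_if_good_subgraph:
  fixes \<Sigma> :: "('p, 'r) vocabulary"
  assumes fin: "finite_vocabulary \<Sigma>" and inf: "infinite (UNIV :: 'u set)"
    and good: "good_subgraph \<Sigma> \<Psi> H (graph_of TYPE('u) \<Sigma> \<Psi>)"
  shows "satisfiable TYPE('u) \<Psi>"
proof -
  obtain r0 zr zs where r0: "r0 \<in> verts H"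
    and zr: "\<And>q P. (q, P) \<in> set (nf_lp \<Psi>) \<Longrightarrow> Pred q X \<in> r0 \<Longrightarrow> constraint H r0 P zr"
    and zs: "\<And>e. e \<in> edges H \<Longrightarrow> edge_system \<Psi> H e (zs e)"
    using good_subgraph_solutions[OF good] by blast
  have gr: "is_graph \<Sigma> H" and sub: "verts H \<subseteq> verts (graph_of TYPE('u) \<Sigma> \<Psi>)"
      "edges H \<subseteq> edges (graph_of TYPE('u) \<Sigma> \<Psi>)" and sym: "symmetric_graph \<Sigma> H"
    using good by (auto simp: good_subgraph_def is_subgraph_def)
  have edge: "\<pi> \<in> unary_types \<Sigma>" "\<eta> \<in> nonnull_types \<Sigma>" "\<eta> \<in> binary_types \<Sigma>" "\<pi>' \<in> unary_types \<Sigma>"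
    "compatible_edge TYPE('u) \<Psi> (\<pi>, \<eta>, \<pi>')" if "(\<pi>, \<eta>, \<pi>') \<in> edges H" for \<pi> \<eta> \<pi>'
    using gr sub that by (auto simp: is_graph_def graph_of_def nonnull_types_def)
  interpret unravelling "edges H" rev_type r0 zr zs
  proof
    fix s l t assume e: "(s, l, t) \<in> edges H"
    then show "(t, rev_type l, s) \<in> edges H"
      using sym edge[OF e] by (auto simp: symmetric_graph_def)
    show "rev_type (rev_type l) = l" using edge[OF e] rev_type_rev_type by blast
    show "zs (s, l, t) (l, t) \<ge> 1" using zs[OF e] by (auto simp: edge_system_def)
  next
    show "finite {(l, t). (s, l, t) \<in> edges H}" for s
      using finite_neighbours[OF fin gr] by (simp add: neighbours_def)
  qed
  have "finite (edges H)"
  proof (rule finite_subset)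
    show "edges H \<subseteq> unary_types \<Sigma> \<times> binary_types \<Sigma> \<times> unary_types \<Sigma>" using edge by auto
    show "finite (unary_types \<Sigma> \<times> binary_types \<Sigma> \<times> unary_types \<Sigma>)"
      using fin by (simp add: finite_unary_types finite_binary_types)
  qed
  note cnt = countable_nodes[OF this]
  define B where "B = \<lparr>carr = nodes, un_rel = \<lambda>p a. Pred p X \<in> tp a,
     bin_rel = \<lambda>r a b. if a = b then Rel r X X \<in> tp a
       else (case lab a b of None \<Rightarrow> False | Some l \<Rightarrow> Rel r X Y \<in> l)\<rparr>"
  have carrB: "carr B = nodes" by (simp add: B_def)
  have tp_type: "tp a \<in> unary_types \<Sigma> \<and> compatible_type TYPE('u) \<Psi> (tp a)" if "a \<in> nodes" for a
    using that
  proof cases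
    case root
    then show ?thesis using r0 sub by (auto simp: graph_of_def)
  next
    case (step l t k w)
    then show ?thesis using edge[OF step(3)] by (auto simp: compatible_edge_def)
  qed
  have sat_tp: "sat B (asg a b) \<psi>" if "a \<in> nodes" "\<psi> \<in> tp a" for a b \<psi>
    using conjunct1[OF tp_type[OF that(1)]] that(2)
    by (rule unary_type_literals) (use that in \<open>auto simp: B_def\<close>)
  have sat_tp_y: "sat B (asg a b) \<psi>" if "b \<in> nodes" "\<psi> \<in> at_y (tp b)" for a b \<psi>
    using that sat_tp[OF that(1)] sat_swap_qf[of B a b] by (auto simp: at_y_def)
  \<comment> \<open>Atoms of the form \<open>Rel r Y X\<close> are evaluated through the label of
    the pair \<open>b\<close>, \<open>a\<close>, which is \<open>rev_type l\<close> by
    \<open>lab_sym\<close>.\<close>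
  have sat_lab: "sat B (asg a b) \<psi>" if "a \<in> nodes" "b \<in> nodes" "lab a b = Some l" "\<psi> \<in> l" for a b l \<psi>
    using edge(3)[OF lab_edge[OF that(3,1,2)]] that(4)
    by (rule binary_type_literals)
      (use that lab_neq[OF that(3)] lab_sym[OF that(3,1,2)] in \<open>auto simp: B_def\<close>)
  have wit: "witnesses B (And (Rel R X Y) (Neq X Y)) a =
      {b \<in> nodes. \<exists>l. lab a b = Some l \<and> Rel R X Y \<in> l}" for R a
    by (auto simp: witnesses_def B_def dest: lab_neq split: option.splits)
  have con: "constraint H (tp a) P (sol a)"
    if "a \<in> nodes" "(q, P) \<in> set (nf_lp \<Psi>)" "Pred q X \<in> tp a" for a q P
    using that(1)
  proof cases
    case root
    then show ?thesis using zr that by auto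
  next
    case (step l t k w)
    \<comment> \<open>The reverse of the entering edge starts at the type of the node itself, so its
      system contains the constraints at \<open>tp a\<close>.\<close>
    then show ?thesis using zs[OF E_rv[OF step(3)]] that by (auto simp: edge_system_def)
  qed
  have "is_model B \<Psi>"
    unfolding is_model_def carrB
  proof (intro conjI ballI, safe)
    fix a assume a: "a \<in> nodes"
    have "sat B (asg a a) (nf_gamma \<Psi>)"
      using tp_type[OF a] a cnt carrB entails_transfer[OF inf, of B "tp a" "nf_gamma \<Psi>" a a]
        sat_tp[OF a] by (simp add: compatible_type_def)
    then show "sat B (\<lambda>_. a) (nf_gamma \<Psi>)" by (simp add: asg_same)
  next
    fix \<alpha> a b assume \<alpha>: "\<alpha> \<in> nf_alphas \<Psi>" and ab: "a \<in> nodes" "b \<in> nodes"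
    show "sat B (asg a b) \<alpha>"
    proof (cases "lab a b")
      \<comment> \<open>The guard fails: either \<open>a = b\<close>, or the pair is unlabelled and
        satisfies no binary atom.\<close>
      case None
      then show ?thesis using \<alpha> by (auto simp: nf_alphas_def B_def)
    next
      case (Some l)
      have "entails TYPE('u) (tp a \<union> l \<union> at_y (tp b)) \<alpha>"
        using edge(5)[OF lab_edge[OF Some ab]] \<alpha> by (auto simp: compatible_edge_def)
      moreover have "sat B (asg a b) \<psi>" if "\<psi> \<in> tp a \<union> l \<union> at_y (tp b)" for \<psi>
        using that sat_tp[OF ab(1)] sat_tp_y[OF ab(2)] sat_lab[OF ab Some] by blast
      ultimately show ?thesis
        using ab cnt carrB entails_transfer[OF inf, of B "tp a \<union> l \<union> at_y (tp b)" \<alpha> a b] by simp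
    qed
  next
    fix q P a assume qP: "(q, P) \<in> set (nf_lp \<Psi>)" and a: "a \<in> nodes" and "sat B (\<lambda>_. a) (Pred q X)"
    then have "Pred q X \<in> tp a" by (simp add: B_def)
    note con = con[OF a qP this]
    \<comment> \<open>With the index sets identified, the number of \<open>R\<close>-witnesses,
      parent included, is the very sum that occurs in the constraint.\<close>
    have "{(\<eta>', \<pi>') \<in> neighbours H (tp a). Rel R X Y \<in> \<eta>'} =
        {(l, t). (tp a, l, t) \<in> edges H \<and> Rel R X Y \<in> l}" for R
      by (auto simp: neighbours_def)
    then have "card (witnesses B (And (Rel R X Y) (Neq X Y)) a) =
        (\<Sum>(\<eta>', \<pi>') \<in> {(\<eta>', \<pi>') \<in> neighbours H (tp a). Rel R X Y \<in> \<eta>'}. sol a (\<eta>', \<pi>'))" for R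
      unfolding wit card_labelled_neighbours[OF a] by (simp add: case_prod_unfold)
    then show "sat_lp B a P"
      using con finite_labelled_neighbours[OF a] unfolding sat_lp_def constraint_def by (simp add: wit)
  qed
  moreover have "carr B \<noteq> {}" using nodes.root carrB by auto
  ultimately show ?thesis using satisfiable_transfer[OF inf] cnt carrB by metis
qed

theorem theorem3p10:
  fixes \<Sigma> :: "('p, 'r) vocabulary"
    and \<Psi> :: "('p, 'r) normal_form"
  assumes "finite_vocabulary \<Sigma>"
    and "nf_over \<Sigma> \<Psi>"
    and "infinite (UNIV :: 'u set)"
  shows "satisfiable TYPE('u) \<Psi> \<longleftrightarrow> (\<exists>H. good_subgraph \<Sigma> \<Psi> H (graph_of TYPE('u) \<Sigma> \<Psi>))"
  using good_realised_graph[OF assms(1,2)] satisfiable_if_good_subgraph[OF assms(1,3)]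
  unfolding satisfiable_def by blast

end
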